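(* Let $n\ge 7$ be an odd integer, and let $C$ and $D$ be (possibly equal) conjugacy classes of the alternating group $A_n$, each consisting of $n$-cycles. Then $CD \supseteq A_n\setminus\{1\}$.
   Context: $A_n$ is the alternating group of even permutations of $\{1,\dots,n\}$. For subsets $C,D$ of a group, $CD=\{cd : c\in C, d\in D\}$. *)

theory Defs
  imports "HOL-Algebra.Sym_Groups" "HOL-Algebra.Group_Action"
begin

definition conjugacy_classes :: "('a, 'b) monoid_scheme \<Rightarrow> 'a set set"
  where "conjugacy_classes G =
           orbits G (carrier G) (\<lambda>g. \<lambda>h \<in> carrier G. g \<otimes>\<^bsub>G\<^esub> h \<otimes>\<^bsub>G\<^esub> inv\<^bsub>G\<^esub> g)"

definition n_cycles :: "nat \<Rightarrow> (nat \<Rightarrow> nat) set"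
  where "n_cycles n = {cycle_of_list cs | cs. cycle cs \<and> length cs = n \<and> set cs \<subseteq> {1..n}}"

end

theory Submission
  imports Defs
begin

text \<open>
  For odd \<open>n\<close>, two \<open>n\<close>-cycles lie in the same class of \<open>A\<^sub>n\<close> iff the words spelling them differ
  by an even relabelling. Prepending an adjacent pair \<open>p, q\<close> to a word \<open>a # zs\<close> of odd length
  multiplies the cycle by the 3-cycle \<open>(a p q)\<close>, is compatible with even relabellings, and works
  for every \<open>a\<close>, because rotating a word of odd length is an even relabelling. Hence if \<open>g\<close> is a
  product of full cycles on \<open>S - {p, q}\<close> from any two prescribed classes, then the same holds on
  \<open>S\<close> for \<open>(a p q)(b p q)g = (a p)(b q)g\<close> when \<open>a \<noteq> b\<close>, and for \<open>(a p q)(b q p)g\<close>, which is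
  \<open>(b a p)g\<close> when \<open>a \<noteq> b\<close> and \<open>g\<close> itself when \<open>a = b\<close>. By these moves every \<open>g\<close> with \<open>g\<^sup>2 \<noteq> 1\<close>
  descends, staying a noninvolution, to the 3-cycles and 5-cycles on five points. On five points
  involutions fail, so an involution is first turned into a noninvolution on two points fewer.
\<close>

section \<open>Words and even relabellings\<close>

text \<open>The alternating group on an arbitrary set instead of \<open>{1..n}\<close>, because the
  descent deletes arbitrary points.\<close>

definition alt_perms :: "'a set \<Rightarrow> ('a \<Rightarrow> 'a) set"
  where "alt_perms S = {h. h permutes S \<and> evenperm h}"

text \<open>A word keeps the starting letter that \<open>cycle_of_list\<close> forgets, so
  relabellings act on words simply transitively and have a definite parity.\<close>

definition words :: "'a set \<Rightarrow> 'a list set"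
  where "words S = {xs. distinct xs \<and> set xs = S}"

text \<open>The universal quantifier over \<^term>\<open>xs\<close> and \<^term>\<open>ys\<close> ranges over all pairs of
  classes of full cycles, because conjugating a cycle relabels its word.\<close>

definition fully_factorable :: "'a set \<Rightarrow> ('a \<Rightarrow> 'a) \<Rightarrow> bool"
  where "fully_factorable S g \<longleftrightarrow> (\<forall>xs \<in> words S. \<forall>ys \<in> words S. \<exists>h \<in> alt_perms S. \<exists>k \<in> alt_perms S.
           g = cycle_of_list (map h xs) \<circ> cycle_of_list (map k ys))"

lemma permutes_imp_permutation: "finite S \<Longrightarrow> h permutes S \<Longrightarrow> permutation h"
  unfolding permutation_permutes by blast

lemma evenperm_comp_permutes:
  assumes "finite S" "h permutes S" "k permutes S"
  shows "evenperm (h \<circ> k) \<longleftrightarrow> evenperm h = evenperm k"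
  using assms by (intro evenperm_comp permutes_imp_permutation)

lemma alt_perms_comp:
  assumes "finite S" "h \<in> alt_perms S" "k \<in> alt_perms S"
  shows "h \<circ> k \<in> alt_perms S"
  using assms evenperm_comp_permutes[of S h k] permutes_compose[of k S h] by (simp add: alt_perms_def)

lemma alt_perms_mono: "S \<subseteq> T \<Longrightarrow> h \<in> alt_perms S \<Longrightarrow> h \<in> alt_perms T"
  by (auto simp: alt_perms_def intro: permutes_subset)

lemma words_map: "h permutes S \<Longrightarrow> xs \<in> words S \<Longrightarrow> map h xs \<in> words S"
  by (auto simp: words_def distinct_map permutes_image intro: inj_on_subset[OF permutes_inj])

text \<open>Matching letters at equal positions is a bijection of \<open>S\<close>, extended by the
  identity outside \<open>S\<close>. Its parity is not under control, so later uses have to correct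
  or compensate it.\<close>

lemma words_relabel:
  assumes "xs \<in> words S" "ys \<in> words S"
  obtains h where "h permutes S" "map h xs = ys"
proof -
  let ?n = "length xs"
  have n: "length ys = ?n"
    using assms by (metis (mono_tags, lifting) distinct_card mem_Collect_eq words_def)
  define f where "f = (\<lambda>x. ys ! (inv_into {..<?n} ((!) xs) x))"
  have X: "bij_betw ((!) xs) {..<?n} S" using assms by (intro bij_betw_nth) (auto simp: words_def)
  have "bij_betw ((!) ys) {..<?n} S" using assms n by (intro bij_betw_nth) (auto simp: words_def)
  with bij_betw_inv_into[OF X] have "bij_betw ((!) ys \<circ> inv_into {..<?n} ((!) xs)) S S"
    by (rule bij_betw_trans)
  then have bf: "bij_betw f S S" by (simp add: f_def comp_def)
  define h where "h = (\<lambda>x. if x \<in> S then f x else x)"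
  have "bij_betw h S S" using bf by (rule bij_betw_cong[THEN iffD1, rotated]) (simp add: h_def)
  then have "h permutes S" by (rule bij_imp_permutes) (simp add: h_def)
  moreover have "map h xs = ys"
  proof (rule nth_equalityI)
    fix i assume "i < length (map h xs)"
    then have i: "i < ?n" by simp
    then have "xs ! i \<in> S" using assms(1) unfolding words_def by (metis (mono_tags) mem_Collect_eq nth_mem)
    moreover have "inv_into {..<?n} ((!) xs) (xs ! i) = i"
      using bij_betw_imp_inj_on[OF X] i by (intro inv_into_f_f) simp_all
    ultimately have "h (xs ! i) = ys ! i" unfolding h_def f_def by simp
    then show "map h xs ! i = ys ! i" using i by simp
  qed (simp add: n)
  ultimately show ?thesis ..
qed

text \<open>If the relabelling onto a word starting with \<open>p, q\<close> is odd, swapping two of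
  the remaining letters makes it even. The bound on \<open>card S\<close> guarantees two such
  letters.\<close>

lemma words_move_to_front:
  assumes "finite S" "xs \<in> words S" "4 \<le> card S" "p \<in> S" "q \<in> S" "p \<noteq> q"
  obtains h zs where "h \<in> alt_perms S" "map h xs = p # q # zs" "zs \<in> words (S - {p, q})"
proof -
  have "card (S - {p, q}) \<ge> 2" using assms by (subst card_Diff_subset) auto
  moreover obtain us where us: "us \<in> words (S - {p, q})"
    using finite_distinct_list[of "S - {p, q}"] assms by (auto simp: words_def)
  ultimately have "length us \<ge> 2" using distinct_card[of us] by (auto simp: words_def)
  then obtain u v vs where uv: "us = u # v # vs"
    by (metis Suc_le_length_iff numeral_2_eq_2)
  have "p # q # us \<in> words S" using us assms by (auto simp: words_def)
  with assms obtain h where h: "h permutes S" "map h xs = p # q # us" by (metis words_relabel)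
  show ?thesis
  proof (cases "evenperm h")
    case True
    with h us show ?thesis by (intro that[of h us]) (auto simp: alt_perms_def)
  next
    case False
    let ?t = "Transposition.transpose u v"
    have t: "u \<in> S - {p,q}" "v \<in> S - {p,q}" "u \<noteq> v" using us uv by (auto simp: words_def)
    then have tS: "?t permutes (S - {p, q})" by (intro permutes_swap_id)
    then have tS': "?t permutes S" by (rule permutes_subset) auto
    have "?t \<circ> h \<in> alt_perms S"
      using evenperm_comp_permutes[OF assms(1) tS' h(1)] permutes_compose[OF h(1) tS'] False t(3)
      by (simp add: alt_perms_def evenperm_swap)
    moreover have "map ?t (map h xs) = p # q # map ?t us"
      using permutes_not_in[OF tS, of p] permutes_not_in[OF tS, of q] unfolding h(2) by simp
    then have "map (?t \<circ> h) xs = p # q # map ?t us" by simp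
    moreover have "map ?t us \<in> words (S - {p, q})" using tS us by (rule words_map)
    ultimately show ?thesis by (rule that)
  qed
qed

section \<open>Parity and rotation of full cycles\<close>

lemma cycle_of_list_permutes: "xs \<in> words S \<Longrightarrow> cycle_of_list xs permutes S"
  using cycle_permutes by (auto simp: words_def)

text \<open>A cycle on \<open>m\<close> letters is a product of \<open>m - 1\<close> transpositions;
  truncated subtraction covers the empty word, which spells the identity.\<close>

lemma evenperm_cycle_of_list: "distinct xs \<Longrightarrow> evenperm (cycle_of_list xs) \<longleftrightarrow> even (length xs - 1)"
proof (induction xs rule: cycle_of_list.induct)
  case (1 i j cs)
  have "evenperm (cycle_of_list (i # j # cs)) \<longleftrightarrow> evenperm (Transposition.transpose i j) = evenperm (cycle_of_list (j # cs))"
    unfolding cycle_of_list.simps(1) by (rule evenperm_comp[OF permutation_swap_id permutation_of_cycle])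
  moreover have "evenperm (cycle_of_list (j # cs)) \<longleftrightarrow> even (length cs)" using 1 by simp
  moreover have "i \<noteq> j" using 1 by simp
  ultimately show ?case by (simp only: evenperm_swap list.size(4)) simp
qed simp_all

text \<open>Rotating a word amounts to relabelling it by a power of its own cycle, and a cycle of
  odd length is an even permutation. So any letter can come first at no cost in parity.\<close>

lemma words_rotate_to:
  assumes "finite S" "odd (card S)" "xs \<in> words S" "a \<in> S"
  obtains k zs where "k \<in> alt_perms S" "map k xs = a # zs" "cycle_of_list (a # zs) = cycle_of_list xs"
proof -
  let ?c = "cycle_of_list xs"
  have d: "distinct xs" "set xs = S" using assms by (auto simp: words_def)
  have l: "odd (length xs)" using assms d distinct_card by metis
  have "evenperm ?c" using evenperm_cycle_of_list[OF d(1)] l by simp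
  then have c: "?c \<in> alt_perms S" using cycle_of_list_permutes assms by (auto simp: alt_perms_def)
  have cn: "?c ^^ m \<in> alt_perms S" for m
  proof (induction m)
    case 0
    show ?case by (simp add: alt_perms_def permutes_id[unfolded id_def] id_def)
  next
    case (Suc m)
    then show ?case unfolding funpow.simps(2) by (rule alt_perms_comp[OF assms(1) c])
  qed
  obtain i where i: "i < length xs" "xs ! i = a" using assms d by (metis in_set_conv_nth)
  have "xs \<noteq> []" using i(1) by auto
  then have "rotate i xs \<noteq> []" "hd (rotate i xs) = a" using i by (simp_all add: hd_rotate_conv_nth)
  then obtain zs where "rotate i xs = a # zs" by (cases "rotate i xs") auto
  then show ?thesis
    using that[OF cn[of i], of zs] cyclic_rotation[OF d(1)] cycle_of_list_rotate_independent[OF d(1)] by metis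
qed

section \<open>Inserting a pair of points into both factors\<close>

text \<open>The two transpositions split off at the front are \<open>(p q)(q a)\<close>, and both
  this product and \<open>(a p)(p q)\<close> send \<open>a\<close> to \<open>p\<close>,
  \<open>p\<close> to \<open>q\<close> and \<open>q\<close> to \<open>a\<close>.\<close>

lemma cycle_of_list_insert_pair:
  assumes "distinct (p # q # a # zs)"
  shows "cycle_of_list (p # q # a # zs) = cycle_of_list [a, p, q] \<circ> cycle_of_list (a # zs)"
proof -
  have "Transposition.transpose p q \<circ> Transposition.transpose q a
      = Transposition.transpose a p \<circ> Transposition.transpose p q"
    using assms by (auto simp: fun_eq_iff transpose_def)
  then show ?thesis by (simp flip: comp_assoc)
qed

lemma alt_perms_fixes: "h \<in> alt_perms S \<Longrightarrow> x \<notin> S \<Longrightarrow> h x = x"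
  by (auto simp: alt_perms_def permutes_def)

text \<open>Rotate the shorter word so that it starts with \<open>a\<close>, then prepend
  \<open>p, q\<close>. The relabelling used fixes \<open>p\<close> and \<open>q\<close>, so it is
  also an even relabelling of the longer word.\<close>

lemma full_cycle_insert_pair:
  assumes S: "finite S" "odd (card S)" and xs: "p # q # xs \<in> words S" and h: "h \<in> alt_perms (S - {p, q})"
    and a: "a \<in> S - {p, q}"
  obtains k where "k \<in> alt_perms S"
    "cycle_of_list (map k (p # q # xs)) = cycle_of_list [a, p, q] \<circ> cycle_of_list (map h xs)"
proof -
  let ?T = "S - {p, q}"
  have pq: "p \<in> S" "q \<in> S" "p \<noteq> q" and xsT: "xs \<in> words ?T" using xs by (auto simp: words_def)
  have "card ?T = card S - 2" using pq by (subst card_Diff_subset) auto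
  moreover have "card {p, q} \<le> card S" using pq S by (intro card_mono) auto
  ultimately have T: "finite ?T" "odd (card ?T)" using S pq by auto
  have "map h xs \<in> words ?T" using h xsT by (auto simp: alt_perms_def intro!: words_map)
  from words_rotate_to[OF T this a] obtain k zs
    where k: "k \<in> alt_perms ?T" "map k (map h xs) = a # zs" "cycle_of_list (a # zs) = cycle_of_list (map h xs)"
    by blast
  have kh: "k \<circ> h \<in> alt_perms ?T" using alt_perms_comp[OF T(1) k(1) h] .
  have m: "map (k \<circ> h) (p # q # xs) = p # q # a # zs"
    using k(2) alt_perms_fixes[OF kh] by simp
  have kS: "k \<circ> h \<in> alt_perms S" using alt_perms_mono[OF _ kh] by auto
  then have "map (k \<circ> h) (p # q # xs) \<in> words S"
    using xs unfolding alt_perms_def by (intro words_map) (auto simp del: o_apply)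
  then have "distinct (p # q # a # zs)" unfolding m by (simp add: words_def)
  from cycle_of_list_insert_pair[OF this] show ?thesis using kS m k(3) that by metis
qed

text \<open>Each factor absorbs one 3-cycle on its left. The pair \<open>r, s\<close> is
  \<open>p, q\<close> in either order, which yields the two kinds of moves used in the
  descent.\<close>

lemma fully_factorable_insert_pair:
  assumes S: "finite S" "odd (card S)" "4 \<le> card S"
    and pq: "p \<in> S" "q \<in> S" "p \<noteq> q" "{r, s} = {p, q}"
    and ab: "a \<in> S - {p, q}" "b \<in> S - {p, q}"
    and g: "fully_factorable (S - {p, q}) g"
  shows "fully_factorable S (cycle_of_list [a, p, q] \<circ> cycle_of_list [b, r, s] \<circ> g)"
  unfolding fully_factorable_def
proof (intro ballI)
  fix xs ys assume "xs \<in> words S" "ys \<in> words S"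
  have rs: "r \<in> S" "s \<in> S" "r \<noteq> s" using pq by (auto simp: doubleton_eq_iff)
  obtain h xs' where h: "h \<in> alt_perms S" "map h xs = p # q # xs'" "xs' \<in> words (S - {p, q})"
    using words_move_to_front[OF S(1) \<open>xs \<in> words S\<close> S(3) pq(1,2,3)] .
  obtain k ys' where k: "k \<in> alt_perms S" "map k ys = r # s # ys'" "ys' \<in> words (S - {p, q})"
    using words_move_to_front[OF S(1) \<open>ys \<in> words S\<close> S(3) rs] unfolding pq(4) .
  obtain u v where uv: "u \<in> alt_perms (S - {p, q})" "v \<in> alt_perms (S - {p, q})"
    and g': "g = cycle_of_list (map u xs') \<circ> cycle_of_list (map v ys')"
    using g h(3) k(3) unfolding fully_factorable_def by blast
  let ?c = "cycle_of_list (map u xs')"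
  have "map u xs' \<in> words (S - {p, q})" using uv h(3) by (auto simp: alt_perms_def intro!: words_map)
  then have c: "?c permutes S - {p, q}" by (rule cycle_of_list_permutes)
  \<comment> \<open>The 3-cycle absorbed by the right factor has to pass to the left of
    \<open>?c\<close>. Conjugation by \<open>?c\<close> fixes \<open>r\<close> and \<open>s\<close>
    and must turn the third letter into \<open>b\<close>, so that letter is the preimage of
    \<open>b\<close>.\<close>
  define b' where "b' = inv' ?c b"
  have b': "b' \<in> S - {p, q}" "?c b' = b"
    using ab(2) permutes_in_image[OF permutes_inv[OF c]] permutes_inverses[OF c] by (auto simp: b'_def)
  have "p # q # xs' \<in> words S" "r # s # ys' \<in> words S"
    using h(3) k(3) pq rs by (auto simp: words_def)
  then obtain u' v' where u': "u' \<in> alt_perms S"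
      "cycle_of_list (map u' (p # q # xs')) = cycle_of_list [a, p, q] \<circ> ?c"
    and v': "v' \<in> alt_perms S"
      "cycle_of_list (map v' (r # s # ys')) = cycle_of_list [b', r, s] \<circ> cycle_of_list (map v ys')"
    using full_cycle_insert_pair[OF S(1,2) _ uv(1) ab(1)]
      full_cycle_insert_pair[OF S(1,2), of r s ys' v b', unfolded pq(4), OF _ uv(2) b'(1)] by metis
  have "distinct [b', r, s]" using b' rs pq(4) by auto
  then have "?c \<circ> cycle_of_list [b', r, s] \<circ> inv' ?c = cycle_of_list (map ?c [b', r, s])"
    using permutes_bij[OF c] by (rule conjugation_of_cycle)
  also have "map ?c [b', r, s] = [b, r, s]"
    using b' c pq(4) by (auto simp: permutes_def)
  finally have "?c \<circ> cycle_of_list [b', r, s] = cycle_of_list [b, r, s] \<circ> ?c"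
    using permutes_inv_o(2)[OF c] unfolding fun_eq_iff comp_apply
    by (metis id_apply)
  then have "cycle_of_list [a, p, q] \<circ> cycle_of_list [b, r, s] \<circ> g
      = cycle_of_list (map u' (map h xs)) \<circ> cycle_of_list (map v' (map k ys))"
    unfolding h(2) k(2) u'(2) v'(2) g' fun_eq_iff by simp
  then show "\<exists>h\<in>alt_perms S. \<exists>k\<in>alt_perms S.
      cycle_of_list [a, p, q] \<circ> cycle_of_list [b, r, s] \<circ> g = cycle_of_list (map h xs) \<circ> cycle_of_list (map k ys)"
    using alt_perms_comp[OF S(1) u'(1) h(1)] alt_perms_comp[OF S(1) v'(1) k(1)]
    unfolding list.map_comp by blast
qed

section \<open>Factorizations on five points\<close>

text \<open>Every word is carried to \<open>w\<close> by a relabelling of one parity or the other.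
  Hence one factorization for each of the four pairs of parities relative to \<open>w\<close> serves
  all pairs of words.\<close>

lemma fully_factorableI:
  assumes "finite S" "w \<in> words S"
    and ex: "\<And>d e. \<exists>h k. h permutes S \<and> k permutes S \<and> evenperm h = d \<and> evenperm k = e \<and>
      g = cycle_of_list (map h w) \<circ> cycle_of_list (map k w)"
  shows "fully_factorable S g"
  unfolding fully_factorable_def
proof (intro ballI)
  fix xs ys assume "xs \<in> words S" "ys \<in> words S"
  with assms(2) obtain u v where u: "u permutes S" "map u xs = w" and v: "v permutes S" "map v ys = w"
    by (metis words_relabel)
  from ex obtain h k where hk: "h permutes S" "k permutes S" "evenperm h = evenperm u" "evenperm k = evenperm v"
    and g: "g = cycle_of_list (map h w) \<circ> cycle_of_list (map k w)" by blast
  have "h \<circ> u \<in> alt_perms S" "k \<circ> v \<in> alt_perms S"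
    using hk evenperm_comp_permutes[OF assms(1) hk(1) u(1)] evenperm_comp_permutes[OF assms(1) hk(2) v(1)]
      permutes_compose[OF u(1) hk(1)] permutes_compose[OF v(1) hk(2)]
    by (simp_all add: alt_perms_def)
  moreover have "g = cycle_of_list (map (h \<circ> u) xs) \<circ> cycle_of_list (map (k \<circ> v) ys)"
    unfolding list.map_comp[symmetric] u(2) v(2) by (rule g)
  ultimately show "\<exists>h\<in>alt_perms S. \<exists>k\<in>alt_perms S. g = cycle_of_list (map h xs) \<circ> cycle_of_list (map k ys)"
    by blast
qed

text \<open>With relabellings given as lists of genuine transpositions, parity is read off from the
  length of the list and explicit witnesses can be checked by simplification.\<close>

lemma fully_factorable_transps:
  assumes "finite S" "w \<in> words S"
    and "\<And>d e. \<exists>hs ks. set hs \<union> set ks \<subseteq> {(i, j). i \<in> S \<and> j \<in> S \<and> i \<noteq> j} \<and>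
      even (length hs) = d \<and> even (length ks) = e \<and>
      g = cycle_of_list (map (apply_transps hs) w) \<circ> cycle_of_list (map (apply_transps ks) w)"
  shows "fully_factorable S g"
proof (rule fully_factorableI[OF assms(1,2)])
  fix d e
  from assms(3)[of d e] obtain hs ks
    where hk: "set hs \<union> set ks \<subseteq> {(i, j). i \<in> S \<and> j \<in> S \<and> i \<noteq> j}"
      "even (length hs) = d" "even (length ks) = e"
      "g = cycle_of_list (map (apply_transps hs) w) \<circ> cycle_of_list (map (apply_transps ks) w)"
    by blast
  have "apply_transps hs permutes S" "apply_transps ks permutes S"
    using hk(1) by (auto intro!: permutes_apply_transps)
  moreover have "evenperm (apply_transps hs) = d" "evenperm (apply_transps ks) = e"
    using hk(1,2,3) evenperm_apply_transps_iff[of hs] evenperm_apply_transps_iff[of ks] by auto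
  ultimately show "\<exists>h k. h permutes S \<and> k permutes S \<and> evenperm h = d \<and> evenperm k = e \<and>
      g = cycle_of_list (map h w) \<circ> cycle_of_list (map k w)"
    using hk(4) by blast
qed

text \<open>The transpositions below were found by a search, one pair of lists for each pair of parities.\<close>

lemma fully_factorable_3_cycle:
  assumes "distinct [a, b, c, d, e]"
  shows "fully_factorable {a, b, c, d, e} (cycle_of_list [a, b, c])"
proof (rule fully_factorable_transps[where w = "[a, b, c, d, e]"])
  have neq: "a \<noteq> b" "a \<noteq> c" "a \<noteq> d" "a \<noteq> e" "b \<noteq> c" "b \<noteq> d" "b \<noteq> e"
    "c \<noteq> d" "c \<noteq> e" "d \<noteq> e"
    using assms by simp_all
  let ?f = "\<lambda>hs. cycle_of_list (map (apply_transps hs) [a, b, c, d, e])"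
  have eq:
    "cycle_of_list [a, b, c] y = (?f [(b, c), (c, d)] \<circ> ?f [(b, d), (d, e)]) y"
    "cycle_of_list [a, b, c] y = (?f [(b, c), (d, e)] \<circ> ?f [(a, b)]) y"
    "cycle_of_list [a, b, c] y = (?f [(b, c)] \<circ> ?f [(b, c), (c, e)]) y"
    "cycle_of_list [a, b, c] y = (?f [(b, e)] \<circ> ?f [(b, d)]) y" for y
    by (cases "y \<in> {a, b, c, d, e}"; (elim insertE emptyE)?; simp add: transpose_def neq neq[symmetric])+
  fix P Q :: bool
  show "\<exists>hs ks. set hs \<union> set ks \<subseteq> {(i, j). i \<in> {a, b, c, d, e} \<and> j \<in> {a, b, c, d, e} \<and> i \<noteq> j} \<and>
      even (length hs) = P \<and> even (length ks) = Q \<and> cycle_of_list [a, b, c] = ?f hs \<circ> ?f ks"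
  proof (cases P; cases Q)
    assume "P" "Q"
    then show ?thesis using neq eq(1)
      by (intro exI[of _ "[(b, c), (c, d)]"] exI[of _ "[(b, d), (d, e)]"] conjI ext) simp_all
  next
    assume "P" "\<not> Q"
    then show ?thesis using neq eq(2)
      by (intro exI[of _ "[(b, c), (d, e)]"] exI[of _ "[(a, b)]"] conjI ext) simp_all
  next
    assume "\<not> P" "Q"
    then show ?thesis using neq eq(3)
      by (intro exI[of _ "[(b, c)]"] exI[of _ "[(b, c), (c, e)]"] conjI ext) simp_all
  next
    assume "\<not> P" "\<not> Q"
    then show ?thesis using neq eq(4)
      by (intro exI[of _ "[(b, e)]"] exI[of _ "[(b, d)]"] conjI ext) simp_all
  qed
qed (use assms in \<open>auto simp: words_def\<close>)

lemma fully_factorable_5_cycle: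
  assumes "distinct [a, b, c, d, e]"
  shows "fully_factorable {a, b, c, d, e} (cycle_of_list [a, b, c, d, e])"
proof (rule fully_factorable_transps[where w = "[a, b, c, d, e]"])
  have neq: "a \<noteq> b" "a \<noteq> c" "a \<noteq> d" "a \<noteq> e" "b \<noteq> c" "b \<noteq> d" "b \<noteq> e"
    "c \<noteq> d" "c \<noteq> e" "d \<noteq> e"
    using assms by simp_all
  let ?f = "\<lambda>hs. cycle_of_list (map (apply_transps hs) [a, b, c, d, e])"
  have eq:
    "cycle_of_list [a, b, c, d, e] y = (?f [(b, c), (d, e)] \<circ> ?f [(b, c), (c, e)]) y"
    "cycle_of_list [a, b, c, d, e] y = (?f [(b, e), (c, d)] \<circ> ?f [(b, c), (c, e), (e, d)]) y"
    "cycle_of_list [a, b, c, d, e] y = (?f [(b, c), (c, e), (e, d)] \<circ> ?f [(b, e), (c, d)]) y"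
    "cycle_of_list [a, b, c, d, e] y = (?f [(b, d), (d, e), (e, c)] \<circ> ?f [(b, d), (d, e), (e, c)]) y" for y
    by (cases "y \<in> {a, b, c, d, e}"; (elim insertE emptyE)?; simp add: transpose_def neq neq[symmetric])+
  fix P Q :: bool
  show "\<exists>hs ks. set hs \<union> set ks \<subseteq> {(i, j). i \<in> {a, b, c, d, e} \<and> j \<in> {a, b, c, d, e} \<and> i \<noteq> j} \<and>
      even (length hs) = P \<and> even (length ks) = Q \<and> cycle_of_list [a, b, c, d, e] = ?f hs \<circ> ?f ks"
  proof (cases P; cases Q)
    assume "P" "Q"
    then show ?thesis using neq eq(1)
      by (intro exI[of _ "[(b, c), (d, e)]"] exI[of _ "[(b, c), (c, e)]"] conjI ext) simp_all
  next
    assume "P" "\<not> Q"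
    then show ?thesis using neq eq(2)
      by (intro exI[of _ "[(b, e), (c, d)]"] exI[of _ "[(b, c), (c, e), (e, d)]"] conjI ext) simp_all
  next
    assume "\<not> P" "Q"
    then show ?thesis using neq eq(3)
      by (intro exI[of _ "[(b, c), (c, e), (e, d)]"] exI[of _ "[(b, e), (c, d)]"] conjI ext) simp_all
  next
    assume "\<not> P" "\<not> Q"
    then show ?thesis using neq eq(4)
      by (intro exI[of _ "[(b, d), (d, e), (e, c)]"] exI[of _ "[(b, d), (d, e), (e, c)]"] conjI ext) simp_all
  qed
qed (use assms in \<open>auto simp: words_def\<close>)

section \<open>Moves that remove two points\<close>

lemma permutes_eqI:
  assumes "f permutes S" "g permutes S" "\<And>x. x \<in> S \<Longrightarrow> f x = g x"
  shows "f = g"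
  using assms by (metis ext permutes_not_in)

text \<open>Without fixed points the sets \<open>{x, g x}\<close> would partition \<open>S\<close>
  into blocks of size two.\<close>

lemma odd_card_involution_fixpoint:
  assumes "finite S" "odd (card S)" "g permutes S" "\<And>x. g (g x) = x"
  obtains q where "q \<in> S" "g q = q"
proof (rule ccontr)
  assume "\<not> thesis"
  then have nofix: "\<And>x. x \<in> S \<Longrightarrow> g x \<noteq> x" using that by blast
  have gS: "g x \<in> S" if "x \<in> S" for x using that assms(3) by (simp add: permutes_in_image)
  let ?C = "(\<lambda>x. {x, g x}) ` S"
  have U: "\<Union> ?C = S" using gS by auto
  have "2 dvd card (\<Union> ?C)"
  proof (rule dvd_partition)
    show "\<forall>c1\<in>?C. \<forall>c2\<in>?C. c1 \<noteq> c2 \<longrightarrow> c1 \<inter> c2 = {}"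
    proof (intro ballI impI)
      fix c1 c2 assume "c1 \<in> ?C" "c2 \<in> ?C" "c1 \<noteq> c2"
      moreover have "{x, g x} = {w, g w}" if "w \<in> {x, g x}" for w x
        using that assms(4)[of x] by (elim insertE emptyE) (simp_all add: insert_commute)
      ultimately show "c1 \<inter> c2 = {}" by (smt (verit) disjoint_iff image_iff)
    qed
    show "\<forall>c\<in>?C. 2 dvd card c" using nofix by (auto simp: eq_commute)
  qed (use U assms(1) in simp)
  with U assms(2) show False by simp
qed

lemma alt_perms_restrict:
  assumes "h \<in> alt_perms S" "h p = p" "h q = q"
  shows "h \<in> alt_perms (S - {p, q})"
  using assms unfolding alt_perms_def by (auto intro: permutes_superset)

lemma transpose_prod_in_alt_perms:
  assumes "finite S" "g \<in> alt_perms S" "a \<in> S" "b \<in> S" "c \<in> S" "d \<in> S" "a \<noteq> b" "c \<noteq> d"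
  shows "Transposition.transpose a b \<circ> Transposition.transpose c d \<circ> g \<in> alt_perms S"
proof -
  have "Transposition.transpose a b \<circ> Transposition.transpose c d \<in> alt_perms S"
    using assms evenperm_comp_permutes[OF assms(1) permutes_swap_id[of a S b] permutes_swap_id[of c S d]]
      permutes_compose[OF permutes_swap_id[of c S d] permutes_swap_id[of a S b]]
    by (simp add: alt_perms_def evenperm_swap)
  then show ?thesis by (rule alt_perms_comp[OF assms(1) _ assms(2)])
qed

text \<open>The inserted 3-cycles \<open>(a p q)\<close> and \<open>(a q p)\<close> are inverse to
  each other, so inserting the pair leaves \<open>g\<close> unchanged.\<close>

lemma fully_factorable_drop_fixpoints:
  assumes S: "finite S" "odd (card S)" "4 \<le> card S"
    and pq: "p \<in> S" "q \<in> S" "p \<noteq> q"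
    and g: "fully_factorable (S - {p, q}) g"
  shows "fully_factorable S g"
proof -
  have "card (S - {p, q}) \<ge> 2" using S pq by (subst card_Diff_subset) auto
  then have "S - {p, q} \<noteq> {}" by (metis card.empty not_numeral_le_zero)
  then obtain a where a: "a \<in> S - {p, q}" by blast
  have "cycle_of_list [a, p, q] \<circ> cycle_of_list [a, q, p] = id"
    using a pq by (auto simp: fun_eq_iff transpose_def)
  then show ?thesis using fully_factorable_insert_pair[OF S pq _ a a g, of q p] by (simp add: insert_commute)
qed

text \<open>The inserted 3-cycles multiply to the involution \<open>(p a)(q b)\<close>. In the
  application \<open>a = g p\<close> and \<open>b = g q\<close>, so that \<open>(p a)(q b)g\<close>
  fixes both \<open>p\<close> and \<open>q\<close>.\<close>

lemma fully_factorable_transpose_prod: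
  assumes S: "finite S" "odd (card S)" "4 \<le> card S"
    and pq: "p \<in> S" "q \<in> S" "p \<noteq> q" and ab: "a \<in> S - {p, q}" "b \<in> S - {p, q}" "a \<noteq> b"
    and g: "fully_factorable (S - {p, q}) (Transposition.transpose p a \<circ> Transposition.transpose q b \<circ> g)"
  shows "fully_factorable S g"
proof -
  have neq: "p \<noteq> q" "a \<noteq> p" "a \<noteq> q" "b \<noteq> p" "b \<noteq> q" "a \<noteq> b" using pq ab by auto
  have "(cycle_of_list [a, p, q] \<circ> cycle_of_list [b, p, q])
      (Transposition.transpose p a (Transposition.transpose q b y)) = y" for y
    by (cases "y \<in> {a, b, p, q}"; (elim insertE emptyE)?; simp add: transpose_def neq neq[symmetric])
  then have "cycle_of_list [a, p, q] \<circ> cycle_of_list [b, p, q]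
      \<circ> (Transposition.transpose p a \<circ> Transposition.transpose q b \<circ> g) = g"
    by (simp add: fun_eq_iff)
  then show ?thesis using fully_factorable_insert_pair[OF S pq refl ab(1,2) g] by simp
qed

text \<open>The inserted 3-cycles multiply to the 3-cycle \<open>a\<close> to \<open>p\<close> to
  \<open>b\<close> to \<open>a\<close>, with inverse \<open>(p a)(a b)\<close>, and \<open>q\<close>
  drops out. In the applications \<open>g\<close> fixes \<open>q\<close> and \<open>b = g p\<close>;
  then \<open>(p a)(a b)g\<close> fixes \<open>p\<close> and \<open>q\<close>, while
  \<open>a\<close> remains free to choose.\<close>

lemma fully_factorable_3_cycle_prod:
  assumes S: "finite S" "odd (card S)" "4 \<le> card S"
    and pq: "p \<in> S" "q \<in> S" "p \<noteq> q" and ab: "a \<in> S - {p, q}" "b \<in> S - {p, q}" "a \<noteq> b"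
    and g: "fully_factorable (S - {p, q}) (Transposition.transpose p a \<circ> Transposition.transpose a b \<circ> g)"
  shows "fully_factorable S g"
proof -
  have neq: "p \<noteq> q" "a \<noteq> p" "a \<noteq> q" "b \<noteq> p" "b \<noteq> q" "a \<noteq> b" using pq ab by auto
  have "(cycle_of_list [a, p, q] \<circ> cycle_of_list [b, q, p])
      (Transposition.transpose p a (Transposition.transpose a b y)) = y" for y
    by (cases "y \<in> {a, b, p, q}"; (elim insertE emptyE)?; simp add: transpose_def neq neq[symmetric])
  then have "cycle_of_list [a, p, q] \<circ> cycle_of_list [b, q, p]
      \<circ> (Transposition.transpose p a \<circ> Transposition.transpose a b \<circ> g) = g"
    by (simp add: fun_eq_iff)
  then show ?thesis using fully_factorable_insert_pair[OF S pq _ ab(1,2) g, of q p] by (simp add: insert_commute)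
qed

section \<open>Descent for noninvolutions\<close>

text \<open>Since \<open>x\<close>, \<open>g x\<close>, \<open>g (g x)\<close> are distinct,
  \<open>g\<close> has a cycle of length at least three. On five points the possible types are 3,
  3+2, 4 and 5, and parity leaves only 3-cycles and 5-cycles.\<close>

lemma noninvolution_fully_factorable_5:
  assumes S: "finite S" "card S = 5" and g: "g \<in> alt_perms S" and x: "g (g x) \<noteq> x"
  shows "fully_factorable S g"
proof -
  have gp: "g permutes S" and ge: "evenperm g" using g by (auto simp: alt_perms_def)
  have gS: "g w \<in> S \<longleftrightarrow> w \<in> S" for w using gp by (rule permutes_in_image)
  have inj: "g v = g w \<longleftrightarrow> v = w" for v w using permutes_inj[OF gp] by (rule inj_eq)
  define y where "y = g x"
  define z where "z = g y"
  have xS: "x \<in> S" using x gp by (metis permutes_not_in)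
  then have yzS: "y \<in> S" "z \<in> S" by (simp_all add: y_def z_def gS)
  have zx: "z \<noteq> x" using x by (simp add: z_def y_def)
  have yx: "y \<noteq> x" using zx by (auto simp: z_def y_def)
  have zy: "z \<noteq> y" using yx unfolding z_def by (metis inj y_def)
  have "card (S - {x, y, z}) = 2" using S xS yzS zx yx zy by (subst card_Diff_subset) auto
  then obtain u v where uv: "S - {x, y, z} = {u, v}" "u \<noteq> v" by (meson card_2_iff)
  have gx: "g x = y" "g y = z" by (simp_all add: y_def z_def)
  \<comment> \<open>Stated for arbitrary names of the two remaining points, so that it covers both
    \<open>g z = u\<close> and \<open>g z = v\<close>.\<close>
  have cyc5: "fully_factorable S g"
    if "g z = u" "S - {x, y, z} = {u, v}" "u \<noteq> v" for u v
  proof -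
    have neq: "x \<noteq> y" "x \<noteq> z" "x \<noteq> u" "x \<noteq> v" "y \<noteq> z" "y \<noteq> u" "y \<noteq> v"
      "z \<noteq> u" "z \<noteq> v" "u \<noteq> v"
      using that(2,3) zx yx zy by blast+
    have d: "distinct [x, y, z, u, v]" using neq by simp
    have "{x, y, z} \<union> (S - {x, y, z}) = S" using xS yzS by blast
    then have Sw: "S = {x, y, z, u, v}" unfolding that(2) by blast
    have "g u \<in> S" "g u \<noteq> y" "g u \<noteq> z" "g u \<noteq> u"
      using inj[of u x] inj[of u y] inj[of u z] gx that(1) gS[of u] Sw neq by auto
    then consider "g u = x" | "g u = v" using Sw by auto
    then show ?thesis
    proof cases
      case 1
      have "g v \<in> S" "g v \<noteq> x" "g v \<noteq> y" "g v \<noteq> z" "g v \<noteq> u" 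
        using inj[of v x] inj[of v y] inj[of v z] inj[of v u] gx that(1) 1 gS[of v] Sw neq by auto
      then have "g v = v" using Sw by auto
      have "g = cycle_of_list [x, y, z, u]"
      proof (rule permutes_eqI[OF gp])
        show "cycle_of_list [x, y, z, u] permutes S"
          by (rule permutes_subset[OF cycle_permutes]) (use Sw in auto)
        show "g w = cycle_of_list [x, y, z, u] w" if "w \<in> S" for w
          using that \<open>g z = u\<close> \<open>g v = v\<close> unfolding Sw
            by (elim insertE emptyE) (simp_all add: transpose_def neq neq[symmetric] gx 1)
      qed
      with ge have False using evenperm_cycle_of_list[of "[x, y, z, u]"] d by simp
      then show ?thesis ..
    next
      case 2
      have "g v \<in> S" "g v \<noteq> v" "g v \<noteq> y" "g v \<noteq> z" "g v \<noteq> u" 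
        using inj[of v x] inj[of v y] inj[of v z] inj[of v u] gx that(1) 2 gS[of v] Sw neq by auto
      then have "g v = x" using Sw by auto
      have "g = cycle_of_list [x, y, z, u, v]"
      proof (rule permutes_eqI[OF gp])
        show "cycle_of_list [x, y, z, u, v] permutes S"
          by (rule permutes_subset[OF cycle_permutes]) (use Sw in auto)
        show "g w = cycle_of_list [x, y, z, u, v] w" if "w \<in> S" for w
          using that \<open>g z = u\<close> \<open>g v = x\<close> unfolding Sw
            by (elim insertE emptyE) (simp_all add: transpose_def neq neq[symmetric] gx 2)
      qed
      then show ?thesis using fully_factorable_5_cycle[OF d] Sw by simp
    qed
  qed
  have "g z \<in> S" "g z \<noteq> y" "g z \<noteq> z" using inj[of z x] inj[of z y] gx yx zy zx yzS gS[of z] by auto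
  then consider "g z = u" | "g z = v" | "g z = x" using uv by blast
  then show ?thesis
  proof cases
    case 1 then show ?thesis using cyc5 uv by blast
  next
    case 2 then show ?thesis using cyc5[of v u] uv by (simp add: insert_commute)
  next
    case 3
    have neq: "x \<noteq> y" "x \<noteq> z" "x \<noteq> u" "x \<noteq> v" "y \<noteq> z" "y \<noteq> u" "y \<noteq> v"
      "z \<noteq> u" "z \<noteq> v" "u \<noteq> v"
      using uv zx yx zy by blast+
    have d: "distinct [x, y, z, u, v]" using neq by simp
    have "{x, y, z} \<union> (S - {x, y, z}) = S" using xS yzS by blast
    then have Sw: "S = {x, y, z, u, v}" unfolding uv(1) by blast
    have gu: "g u \<in> S" "g u \<noteq> x" "g u \<noteq> y" "g u \<noteq> z" and gv: "g v \<in> S" "g v \<noteq> x" "g v \<noteq> y" "g v \<noteq> z"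
      using inj[of u x] inj[of u y] inj[of u z] inj[of v x] inj[of v y] inj[of v z] gx 3 gS[of u] gS[of v] Sw neq
      by auto
    \<comment> \<open>Otherwise \<open>g\<close> would swap \<open>u\<close> and \<open>v\<close>
      besides its 3-cycle, and so be odd.\<close>
    have "g u = u"
    proof (rule ccontr)
      assume "g u \<noteq> u"
      then have "g u = v" "g v = u" using gu gv Sw inj[of u v] \<open>u \<noteq> v\<close> by auto
      have "g = Transposition.transpose u v \<circ> cycle_of_list [x, y, z]"
      proof (rule permutes_eqI[OF gp])
        show "Transposition.transpose u v \<circ> cycle_of_list [x, y, z] permutes S"
          by (intro permutes_compose permutes_swap_id permutes_subset[OF cycle_permutes]) (use Sw in auto)
        show "g w = (Transposition.transpose u v \<circ> cycle_of_list [x, y, z]) w" if "w \<in> S" for w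
          using that \<open>g u = v\<close> \<open>g v = u\<close> unfolding Sw
            by (elim insertE emptyE) (simp_all add: transpose_def neq neq[symmetric] gx 3)
      qed
      then have "evenperm g \<longleftrightarrow> evenperm (Transposition.transpose u v) = evenperm (cycle_of_list [x, y, z])"
        by (simp only: evenperm_comp permutation_swap_id permutation_of_cycle)
      with ge show False
        using evenperm_cycle_of_list[of "[x, y, z]"] d by (simp only: evenperm_swap) simp
    qed
    then have "g v = v" using gv Sw inj[of u v] \<open>u \<noteq> v\<close> by auto
    have "g = cycle_of_list [x, y, z]"
    proof (rule permutes_eqI[OF gp])
      show "cycle_of_list [x, y, z] permutes S"
        by (rule permutes_subset[OF cycle_permutes]) (use Sw in auto)
      show "g w = cycle_of_list [x, y, z] w" if "w \<in> S" for w
        using that \<open>g u = u\<close> \<open>g v = v\<close> unfolding Sw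
            by (elim insertE emptyE) (simp_all add: transpose_def neq neq[symmetric] gx 3)
    qed
    then show ?thesis using fully_factorable_3_cycle[OF d] Sw by simp
  qed
qed

text \<open>Induction removing two points at a time. The removed points and the auxiliary point
  \<open>a\<close> avoid \<open>x\<close>, \<open>g x\<close> and \<open>g (g x)\<close>, so the
  modified permutation agrees with \<open>g\<close> at \<open>x\<close> and \<open>g x\<close>, and
  \<open>x\<close> still witnesses that it is no involution.\<close>

lemma noninvolution_fully_factorable:
  assumes "finite S" "odd (card S)" "5 \<le> card S" "g \<in> alt_perms S" "g (g x) \<noteq> x"
  shows "fully_factorable S g"
  using assms
proof (induction "card S" arbitrary: S g x rule: less_induct)
  case less
  note S = less.prems(1,2) and g = less.prems(4) and x = less.prems(5)
  show ?case
  proof (cases "card S = 5")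
    case True
    then show ?thesis using noninvolution_fully_factorable_5[OF S(1) _ g x] by simp
  next
    case False
    with less.prems(2,3) have S7: "7 \<le> card S" by presburger
    then have S4: "4 \<le> card S" by simp
    have gp: "g permutes S" using g by (auto simp: alt_perms_def)
    have gS: "g w \<in> S \<longleftrightarrow> w \<in> S" for w using gp by (rule permutes_in_image)
    have inj: "g v = g w \<longleftrightarrow> v = w" for v w using permutes_inj[OF gp] by (rule inj_eq)
    have IH: "fully_factorable (S - {p, q}) g'"
      if "p \<in> S" "q \<in> S" "p \<noteq> q" "g' \<in> alt_perms S" "g' p = p" "g' q = q" "g' (g' x) \<noteq> x" for p q g'
    proof (rule less.hyps[of "S - {p, q}" g' x])
      have "card (S - {p, q}) = card S - 2" using that by (subst card_Diff_subset) auto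
      then show "card (S - {p, q}) < card S" "odd (card (S - {p, q}))" "5 \<le> card (S - {p, q})"
        using S7 S(2) by auto
      show "g' \<in> alt_perms (S - {p, q})" using that by (intro alt_perms_restrict)
    qed (use that S in simp_all)
    define T where "T = {x, g x, g (g x)}"
    have "x \<in> S" using x gp by (metis permutes_not_in)
    then have "T \<subseteq> S" by (simp add: T_def gS)
    have gxx: "g x \<noteq> x" "g (g x) \<noteq> g x" using x inj by metis+
    have "card (S - T) = card S - card T"
      using \<open>T \<subseteq> S\<close> by (intro card_Diff_subset) (simp_all add: T_def)
    moreover have "card T \<le> 3" unfolding T_def by (simp add: card_insert_if)
    ultimately have cT: "4 \<le> card (S - T)" using S7 by simp
    \<comment> \<open>At least four points lie outside \<open>T\<close>, so three further points can
      always be avoided.\<close>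
    have pick: "\<exists>w. w \<in> S - T \<and> w \<notin> {u1, u2, u3}" for u1 u2 u3
    proof -
      have "card {u1, u2, u3} \<le> 3" by (simp add: card_insert_if)
      moreover have "card (S - T) \<le> card {u1, u2, u3}" if "S - T \<subseteq> {u1, u2, u3}"
        using that by (intro card_mono) auto
      ultimately have "\<not> S - T \<subseteq> {u1, u2, u3}" using cT by linarith
      then show ?thesis by blast
    qed
    show ?thesis
    \<comment> \<open>Given a fixed point \<open>q\<close>, a single further point \<open>p\<close>
      has to be made fixed, if it is not fixed already. Without fixed points, two points are made
      fixed at once by a double transposition.\<close>
    proof (cases "\<exists>q \<in> S. g q = q")
      case True
      then obtain q where q: "q \<in> S" "g q = q" by blast
      have qT: "q \<notin> T" unfolding T_def
        using q(2) x gxx inj[of "g (g x)" "g x"] by (auto simp del: insert_iff elim!: insertE)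
      show ?thesis
      proof (cases "\<exists>p \<in> S - T. g p \<noteq> p")
        case True
        then obtain p where p: "p \<in> S - T" "g p \<noteq> p" by blast
        obtain a where a: "a \<in> S - T" "a \<notin> {q, p, g p}" using pick by blast
        let ?t = "Transposition.transpose p a \<circ> Transposition.transpose a (g p)"
        have pq: "p \<noteq> q" "g p \<noteq> q" using p q inj by metis+
        have same: "(?t \<circ> g) y = g y" if "g y \<notin> {p, a, g p}" for y
          using that by (simp add: transpose_def)
        have "g x \<notin> {p, a, g p}" "g (g x) \<notin> {p, a, g p}"
          using p a inj by (auto simp: T_def)
        then have "(?t \<circ> g) ((?t \<circ> g) x) \<noteq> x" using same x by metis
        moreover have "(?t \<circ> g) p = p" "(?t \<circ> g) q = q"
          using p a q pq by (auto simp: transpose_def)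
        moreover have "?t \<circ> g \<in> alt_perms S"
          using S(1) g p a gS by (intro transpose_prod_in_alt_perms) auto
        ultimately have "fully_factorable (S - {p, q}) (?t \<circ> g)"
          using IH[of p q "?t \<circ> g"] p q pq by blast
        then show ?thesis
          using fully_factorable_3_cycle_prod[OF S S4, of p q a "g p" g] p q pq a gS by auto
      next
        case False
        obtain p where p: "p \<in> S - T" "p \<noteq> q" using pick[of q q q] by blast
        with False have "g p = p" by blast
        with p q have "fully_factorable (S - {p, q}) g" using IH[of p q g] g x by blast
        then show ?thesis using fully_factorable_drop_fixpoints[OF S S4] p q by blast
      qed
    next
      case False
      then have nofix: "\<And>y. y \<in> S \<Longrightarrow> g y \<noteq> y" by blast
      obtain p where p: "p \<in> S - T" using pick by blast
      \<comment> \<open>Avoiding \<open>g p\<close> and the preimage of \<open>p\<close> makes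
        \<open>p\<close>, \<open>q\<close>, \<open>g p\<close>, \<open>g q\<close> four distinct
        points, so the two transpositions are disjoint.\<close>
      obtain q where q: "q \<in> S - T" "q \<notin> {p, g p, inv' g p}" using pick by blast
      have gq: "g q \<noteq> p" using q(2) permutes_inverses(2)[OF gp] by auto
      let ?t = "Transposition.transpose p (g p) \<circ> Transposition.transpose q (g q)"
      have neq: "g p \<noteq> p" "g q \<noteq> q" "p \<noteq> q" "g p \<noteq> q" "g p \<noteq> g q"
        using nofix p q inj by auto
      have same: "(?t \<circ> g) y = g y" if "g y \<notin> {p, q, g p, g q}" for y
        using that by (simp add: transpose_def)
      have "g x \<notin> {p, q, g p, g q}" "g (g x) \<notin> {p, q, g p, g q}"
        using p q inj by (auto simp: T_def)
      then have "(?t \<circ> g) ((?t \<circ> g) x) \<noteq> x" using same x by metis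
      moreover have "(?t \<circ> g) p = p" "(?t \<circ> g) q = q"
        using neq gq by (simp_all add: transpose_def)
      moreover have "?t \<circ> g \<in> alt_perms S"
        using S(1) g p q gS neq by (intro transpose_prod_in_alt_perms) auto
      ultimately have "fully_factorable (S - {p, q}) (?t \<circ> g)"
        using IH[of p q "?t \<circ> g"] p q neq by blast
      then show ?thesis
        using fully_factorable_transpose_prod[OF S S4, of p q "g p" "g q" g] p q neq gq gS by auto
    qed
  qed
qed

section \<open>Involutions\<close>

text \<open>For an involution, one 3-cycle move fuses parts of two of its transpositions and
  produces a noninvolution. Seven points leave at least five after the move, enough for the descent
  to apply.\<close>

lemma nonidentity_fully_factorable:
  assumes S: "finite S" "odd (card S)" "7 \<le> card S" and g: "g \<in> alt_perms S" "g \<noteq> id"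
  shows "fully_factorable S g"
proof (cases "\<exists>x. g (g x) \<noteq> x")
  case True
  then show ?thesis using noninvolution_fully_factorable[OF S(1,2) _ g(1)] S(3) by auto
next
  case False
  then have gg: "g (g x) = x" for x by blast
  have gp: "g permutes S" and ge: "evenperm g" using g by (auto simp: alt_perms_def)
  have gS: "g w \<in> S \<longleftrightarrow> w \<in> S" for w using gp by (rule permutes_in_image)
  obtain q where q: "q \<in> S" "g q = q" using odd_card_involution_fixpoint[OF S(1,2) gp gg] .
  from g(2) obtain p where p: "g p \<noteq> p" by (auto simp: fun_eq_iff)
  then have pS: "p \<in> S" using gp by (metis permutes_not_in)
  \<comment> \<open>An even permutation is not a single transposition, so \<open>g\<close> moves a
    point besides \<open>p\<close> and \<open>g p\<close>.\<close>
  have "\<exists>a. a \<notin> {p, g p} \<and> g a \<noteq> a"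
  proof (rule ccontr)
    assume "\<nexists>a. a \<notin> {p, g p} \<and> g a \<noteq> a"
    then have "g = Transposition.transpose p (g p)" using gg by (auto simp: fun_eq_iff transpose_def)
    then show False using ge p by (metis evenperm_swap)
  qed
  then obtain a where a: "a \<notin> {p, g p}" "g a \<noteq> a" by blast
  then have aS: "a \<in> S" using gp by (metis permutes_not_in)
  have neq: "p \<noteq> q" "g p \<noteq> q" "a \<noteq> q" "a \<noteq> p" "a \<noteq> g p" "g a \<noteq> p" "g a \<noteq> g p"
    using p q a gg by (metis insertI1 insertI2 singletonI)+
  let ?t = "Transposition.transpose p a \<circ> Transposition.transpose a (g p)"
  have "(?t \<circ> g) p = p" "(?t \<circ> g) q = q"
    using p neq q by (simp_all add: transpose_def)
  moreover have tg: "?t \<circ> g \<in> alt_perms S"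
    using S(1) g pS aS gS neq by (intro transpose_prod_in_alt_perms) auto
  ultimately have "?t \<circ> g \<in> alt_perms (S - {p, q})" by (intro alt_perms_restrict)
  \<comment> \<open>The modified permutation sends \<open>g p\<close> to \<open>a\<close> and
    \<open>a\<close> to \<open>g a\<close>, which differs from \<open>g p\<close>.\<close>
  moreover have "(?t \<circ> g) ((?t \<circ> g) (g p)) \<noteq> g p"
    using p neq a(2) gg by (simp add: transpose_def)
  moreover have "card (S - {p, q}) = card S - 2" using pS q neq by (subst card_Diff_subset) auto
  ultimately have "fully_factorable (S - {p, q}) (?t \<circ> g)"
    using S by (intro noninvolution_fully_factorable[where x = "g p"]) auto
  then show ?thesis
    using fully_factorable_3_cycle_prod[OF S(1,2), of p q a "g p" g] S(3) pS q aS neq p gS by auto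
qed

section \<open>Conjugacy classes of the alternating group\<close>

text \<open>A class consists of the conjugates of one \<open>c\<close> by even permutations, and
  conjugating a cycle relabels its word. Since \<open>c\<close> lies in its own class, it is itself
  an \<open>n\<close>-cycle and its word uses every point.\<close>

lemma conjugacy_class_of_n_cycles:
  assumes "C \<in> conjugacy_classes (alt_group n)" "C \<subseteq> n_cycles n"
  obtains cs where "cs \<in> words {1..n}" "\<And>h. h \<in> alt_perms {1..n} \<Longrightarrow> cycle_of_list (map h cs) \<in> C"
proof -
  let ?G = "alt_group n"
  have carrier: "carrier ?G = alt_perms {1..n}"
    by (auto simp: alt_group_carrier alt_perms_def)
  obtain c where c: "c \<in> carrier ?G"
    and C: "C = {h \<otimes>\<^bsub>?G\<^esub> c \<otimes>\<^bsub>?G\<^esub> inv\<^bsub>?G\<^esub> h | h. h \<in> carrier ?G}"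
    using assms(1) by (auto simp: conjugacy_classes_def orbits_def orbit_def)
  interpret group ?G by (rule alt_group_is_group)
  have "\<one>\<^bsub>?G\<^esub> \<otimes>\<^bsub>?G\<^esub> c \<otimes>\<^bsub>?G\<^esub> inv\<^bsub>?G\<^esub> \<one>\<^bsub>?G\<^esub> = c" using c by simp
  then have "c \<in> C" unfolding C using one_closed by (metis (mono_tags, lifting) mem_Collect_eq)
  with assms(2) obtain cs where cs: "c = cycle_of_list cs" "distinct cs" "length cs = n" "set cs \<subseteq> {1..n}"
    by (auto simp: n_cycles_def)
  have "set cs = {1..n}" using cs distinct_card[of cs] by (intro card_subset_eq) auto
  then have "cs \<in> words {1..n}" using cs by (simp add: words_def)
  moreover have "cycle_of_list (map h cs) \<in> C" if h: "h \<in> alt_perms {1..n}" for h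
  proof -
    have "h \<otimes>\<^bsub>?G\<^esub> c \<otimes>\<^bsub>?G\<^esub> inv\<^bsub>?G\<^esub> h = cycle_of_list (map h cs)"
      using h conjugation_of_cycle[OF cs(2), of h] permutes_bij[of h "{1..n}"]
      by (simp add: alt_group_mult alt_group_inv_equality carrier cs(1) alt_perms_def)
    then show ?thesis unfolding C using h carrier by force
  qed
  ultimately show ?thesis by (rule that)
qed

theorem theorem1:
  fixes n :: nat and C D :: "(nat \<Rightarrow> nat) set"
  assumes "n \<ge> 7" and "odd n"
    and "C \<in> conjugacy_classes (alt_group n)" and "C \<subseteq> n_cycles n"
    and "D \<in> conjugacy_classes (alt_group n)" and "D \<subseteq> n_cycles n"
  shows "carrier (alt_group n) - {\<one>\<^bsub>alt_group n\<^esub>} \<subseteq> C <#>\<^bsub>alt_group n\<^esub> D"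
proof
  fix g assume "g \<in> carrier (alt_group n) - {\<one>\<^bsub>alt_group n\<^esub>}"
  then have "g \<in> alt_perms {1..n}" "g \<noteq> id"
    by (auto simp: alt_group_carrier alt_group_one alt_perms_def)
  with assms(1,2) have g: "fully_factorable {1..n} g" by (intro nonidentity_fully_factorable) auto
  obtain cs where cs: "cs \<in> words {1..n}" "\<And>h. h \<in> alt_perms {1..n} \<Longrightarrow> cycle_of_list (map h cs) \<in> C"
    using conjugacy_class_of_n_cycles[OF assms(3,4)] by metis
  obtain ds where ds: "ds \<in> words {1..n}" "\<And>h. h \<in> alt_perms {1..n} \<Longrightarrow> cycle_of_list (map h ds) \<in> D"
    using conjugacy_class_of_n_cycles[OF assms(5,6)] by metis
  obtain h k where "h \<in> alt_perms {1..n}" "k \<in> alt_perms {1..n}"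
    and "g = cycle_of_list (map h cs) \<circ> cycle_of_list (map k ds)"
    using g cs(1) ds(1) unfolding fully_factorable_def by blast
  with cs(2)[of h] ds(2)[of k] show "g \<in> C <#>\<^bsub>alt_group n\<^esub> D"
    unfolding set_mult_def alt_group_mult by blast
qed

end
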